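(* Let $q\in\mathbb{Q}\cap\mathbb{Z}_2$ and let $a,k,b,v\in\mathbb{N}$ with $a<2^k$, $b<2^v$ and $q=a+2^k\bar{b}_{v,\infty}$. Suppose the binary digit expansion of $\Phi(q)$ is $r_0r_1\cdots r_{u-1}\overline{r_ur_{u+1}\cdots r_{u+p-1}}$ (i.e. $r_{i+p}=r_i$ for all $i\geq u$), and choose $t\in\mathbb{N}$ with $k+tv\geq u$. Then for every positive integer $H$, $$R_{k+tv}\left(\Phi\left(L_{k+tv}(q)\right)\right)\equiv R_{k+(t+p2^H)v}\left(\Phi\left(L_{k+(t+p2^H)v}(q)\right)\right)\pmod{2^{H+2}}.$$
   Context: $\mathbb{Z}_2$ is the ring of $2$-adic integers; $\mathbb{N}=\{0,1,2,\dots\}$. Every $x\in\mathbb{Z}_2$ has a unique expansion $x=\sum_{i\geq0}d_i2^i$ with $d_i\in\{0,1\}$, written $x=d_0d_1d_2\cdots$; an overline denotes a block of digits repeated forever. The map $\Phi:\mathbb{Z}_2\to\mathbb{Z}_2$ is defined as follows: if $x=\sum_i 2^{e_i}$ with $0\leq e_0<e_1<\cdots$ (finite or infinite sum; $x=0$ is the empty sum), then $\Phi(x)=-\sum_i 2^{e_i}3^{-i}$ ($\Phi(0)=0$). For $x\in\mathbb{Z}_2$ and $c\in\mathbb{N}$, $L_c(x)$ is the least natural number congruent to $x$ modulo $2^c$, and $R_c(x)=d_cd_{c+1}\cdots=\sum_{i\geq0}d_{c+i}2^i$. For $b,v,t\in\mathbb{N}$, $\bar{b}_{v,t}=b\sum_{i=0}^{t-1}2^{vi}$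 and $\bar{b}_{v,\infty}=b\sum_{i=0}^{\infty}2^{vi}$. *)

theory Defs
  imports Complex_Main "HOL-Library.Infinite_Set"
begin

section \<open>The ring of 2-adic integers\<close>

text \<open>The inverse limit of the rings \<open>\<int>/2\<^sup>n\<int>\<close>: \<open>res x n\<close> is the
  representative of \<open>x\<close> modulo \<open>2\<^sup>n\<close> in \<open>{0..<2\<^sup>n}\<close>.\<close>

typedef two_adic = "{f :: nat \<Rightarrow> int. \<forall>n. f (Suc n) mod 2 ^ n = f n}"
  morphisms res Abs_two_adic
  by (rule exI[of _ "\<lambda>_. 0"]) simp

setup_lifting type_definition_two_adic

lemma mod_2_power_mod_Suc: "k mod 2 ^ Suc n mod 2 ^ n = (k mod 2 ^ n :: int)"
  by (rule mod_mod_cancel) (rule le_imp_power_dvd, simp)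

instantiation two_adic :: comm_ring_1
begin

lift_definition zero_two_adic :: two_adic is "\<lambda>n. 0" by simp

lift_definition one_two_adic :: two_adic is "\<lambda>n. 1 mod 2 ^ n"
  by (simp only: mod_2_power_mod_Suc simp_thms)

lift_definition uminus_two_adic :: "two_adic \<Rightarrow> two_adic" is "\<lambda>f n. (- f n) mod 2 ^ n"
  unfolding mod_2_power_mod_Suc by (metis mod_minus_eq mod_mod_trivial)

lift_definition plus_two_adic :: "two_adic \<Rightarrow> two_adic \<Rightarrow> two_adic"
  is "\<lambda>f g n. (f n + g n) mod 2 ^ n"
  unfolding mod_2_power_mod_Suc by (metis mod_add_eq mod_mod_trivial)

lift_definition minus_two_adic :: "two_adic \<Rightarrow> two_adic \<Rightarrow> two_adic"
  is "\<lambda>f g n. (f n - g n) mod 2 ^ n"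
  unfolding mod_2_power_mod_Suc by (metis mod_diff_eq mod_mod_trivial)

lift_definition times_two_adic :: "two_adic \<Rightarrow> two_adic \<Rightarrow> two_adic"
  is "\<lambda>f g n. (f n * g n) mod 2 ^ n"
  unfolding mod_2_power_mod_Suc by (metis mod_mult_eq mod_mod_trivial)

lemma coherent_mod: "(\<forall>n. f (Suc n) mod 2 ^ n = f n) \<Longrightarrow> f n mod 2 ^ n = (f n :: int)"
  by (metis mod_mod_trivial)

instance
proof
  fix a b c :: two_adic
  show "a * b * c = a * (b * c)"
    by transfer (simp add: fun_eq_iff mod_simps mult.assoc)
  show "a * b = b * a"
    by transfer (simp add: mult.commute)
  show "1 * a = a"
    by transfer (simp only: mod_mult_left_eq mult_1, rule ext, rule coherent_mod)
  show "a + b + c = a + (b + c)"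
    by transfer (simp add: fun_eq_iff mod_simps add.assoc)
  show "a + b = b + a"
    by transfer (simp add: add.commute)
  show "0 + a = a"
    by transfer (simp add: fun_eq_iff coherent_mod)
  show "- a + a = 0"
    by transfer (simp add: fun_eq_iff mod_simps)
  show "a - b = a + - b"
    by transfer (simp add: fun_eq_iff mod_simps)
  show "(a + b) * c = a * c + b * c"
    by transfer (simp add: fun_eq_iff mod_simps distrib_right)
  show "(0::two_adic) \<noteq> 1"
    by transfer (auto simp: fun_eq_iff intro!: exI[of _ 1])
qed

end

lemma res_zero [simp]: "res 0 n = 0" by transfer simp
lemma res_one: "res 1 n = 1 mod 2 ^ n" by transfer simp
lemma res_uminus: "res (- x) n = (- res x n) mod 2 ^ n" by transfer simp
lemma res_add: "res (x + y) n = (res x n + res y n) mod 2 ^ n" by transfer simp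
lemma res_diff: "res (x - y) n = (res x n - res y n) mod 2 ^ n" by transfer simp
lemma res_mult: "res (x * y) n = (res x n * res y n) mod 2 ^ n" by transfer simp

lemma res_Suc_mod: "res x (Suc n) mod 2 ^ n = res x n"
  using res[of x] by simp

lemma res_mod [simp]: "res x n mod 2 ^ n = res x n"
  using res[of x] by (simp add: coherent_mod)

lemma res_mod_le: "n \<le> m \<Longrightarrow> res x m mod 2 ^ n = res x n"
proof (induction m rule: dec_induct)
  case (step m)
  have "res x (Suc m) mod 2 ^ n = res x (Suc m) mod 2 ^ m mod 2 ^ n"
    using step.hyps by (simp add: mod_mod_cancel le_imp_power_dvd)
  then show ?case using step.IH by (simp add: res_Suc_mod)
qed simp

lemma res_nonneg [simp]: "0 \<le> res x n"
  by (metis res_mod pos_mod_sign zero_less_numeral zero_less_power)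

lemma res_less [simp]: "res x n < 2 ^ n"
  by (metis res_mod pos_mod_bound zero_less_numeral zero_less_power)

lemma two_adic_eqI: "(\<And>n. res x n = res y n) \<Longrightarrow> x = y"
  by (metis ext res_inject)

lemma res_of_nat: "res (of_nat k) n = int k mod 2 ^ n"
  by (induction k) (simp_all add: res_one res_add mod_simps)

lemma res_of_int: "res (of_int k) n = k mod 2 ^ n"
  by (cases k rule: int_diff_cases) (simp add: res_diff res_of_nat mod_simps)

lemma res_sum_of_int: "res (\<Sum>i\<in>A. of_int (f i)) n = (\<Sum>i\<in>A. f i) mod 2 ^ n"
  by (simp only: of_int_sum[symmetric] res_of_int)

lemma two_power_dvd_iff: "2 ^ n dvd x \<longleftrightarrow> res x n = 0"
proof
  assume "2 ^ n dvd x"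
  then obtain y where "x = of_int (2 ^ n) * y" by (auto elim: dvdE)
  then show "res x n = 0" by (simp only: res_mult res_of_int) simp
next
  assume *: "res x n = 0"
  have dvd: "2 ^ n dvd res x (n + m)" for m
    using res_mod_le[of n "n + m" x] * by (simp add: dvd_eq_mod_eq_0)
  define g where "g m = res x (n + m) div 2 ^ n" for m
  have g: "res x (n + m) = 2 ^ n * g m" for m
    using dvd[of m] by (simp add: g_def)
  have coh: "g (Suc m) mod 2 ^ m = g m" for m
  proof -
    have "2 ^ n * g m = (2 ^ n * g (Suc m)) mod (2 ^ n * 2 ^ m)"
      using res_Suc_mod[of x "n + m"] by (simp add: g[symmetric] power_add[symmetric])
    also have "\<dots> = 2 ^ n * (g (Suc m) mod 2 ^ m)"
      by (simp only: mult_mod_right)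
    finally show ?thesis by simp
  qed
  define y where "y = Abs_two_adic g"
  have y: "res y m = g m" for m
    unfolding y_def using coh by (subst Abs_two_adic_inverse) auto
  have "x = of_int (2 ^ n) * y"
  proof (rule two_adic_eqI)
    fix m
    have "res (of_int (2 ^ n) * y) m = (2 ^ n * g m) mod 2 ^ m"
      by (simp only: res_mult res_of_int y mod_simps)
    also have "\<dots> = res x m"
      using res_mod_le[of m "n + m" x] by (simp add: g)
    finally show "res x m = res (of_int (2 ^ n) * y) m" by simp
  qed
  then show "2 ^ n dvd x" by simp
qed

section \<open>The 2-adic topology\<close>

instantiation two_adic :: t2_space
begin

definition open_two_adic :: "two_adic set \<Rightarrow> bool" where
  "open_two_adic S \<longleftrightarrow> (\<forall>x\<in>S. \<exists>n. \<forall>y. 2 ^ n dvd (y - x) \<longrightarrow> y \<in> S)"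

instance
proof
  show "open (UNIV :: two_adic set)" by (simp add: open_two_adic_def)
next
  fix S T :: "two_adic set"
  assume ST: "open S" "open T"
  show "open (S \<inter> T)"
    unfolding open_two_adic_def
  proof
    fix x assume "x \<in> S \<inter> T"
    then obtain m n where "\<forall>y. 2 ^ m dvd (y - x) \<longrightarrow> y \<in> S" "\<forall>y. 2 ^ n dvd (y - x) \<longrightarrow> y \<in> T"
      using ST unfolding open_two_adic_def by (metis IntD1 IntD2)
    then have "\<forall>y. 2 ^ max m n dvd (y - x) \<longrightarrow> y \<in> S \<inter> T"
      by (meson IntI power_le_dvd max.cobounded1 max.cobounded2)
    then show "\<exists>n. \<forall>y. 2 ^ n dvd (y - x) \<longrightarrow> y \<in> S \<inter> T" ..
  qed
next
  fix K :: "two_adic set set"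
  assume "\<forall>S\<in>K. open S"
  then show "open (\<Union>K)" unfolding open_two_adic_def by (meson Union_iff)
next
  fix x y :: two_adic
  assume "x \<noteq> y"
  then obtain n where n: "res x n \<noteq> res y n" using two_adic_eqI by blast
  have op: "open {z. res z n = r}" for r
    unfolding open_two_adic_def
  proof (intro ballI exI[of _ n] allI impI)
    fix w z assume w: "w \<in> {z. res z n = r}" and "2 ^ n dvd (z - w)"
    then have "(res z n - res w n) mod 2 ^ n = 0"
      by (simp add: two_power_dvd_iff res_diff)
    then have "res z n mod 2 ^ n = res w n mod 2 ^ n"
      by (metis mod_eq_dvd_iff dvd_eq_mod_eq_0)
    then show "z \<in> {z. res z n = r}" using w by simp
  qed
  show "\<exists>U V. open U \<and> open V \<and> x \<in> U \<and> y \<in> V \<and> U \<inter> V = {}"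
    using n by (intro exI[of _ "{z. res z n = res x n}"] exI[of _ "{z. res z n = res y n}"])
      (auto simp: op)
qed

end

lemma two_power_dvd_diff_iff: "2 ^ n dvd (x - y) \<longleftrightarrow> res x n = res y n"
proof -
  have "2 ^ n dvd (x - y) \<longleftrightarrow> res x n mod 2 ^ n = res y n mod 2 ^ n"
    by (simp only: two_power_dvd_iff res_diff mod_eq_dvd_iff dvd_eq_mod_eq_0)
  then show ?thesis by simp
qed

lemma LIMSEQ_two_adic_iff:
  fixes X :: "nat \<Rightarrow> two_adic"
  shows "X \<longlonglongrightarrow> x \<longleftrightarrow> (\<forall>n. \<forall>\<^sub>F m in sequentially. res (X m) n = res x n)"
proof
  assume lim: "X \<longlonglongrightarrow> x"
  show "\<forall>n. \<forall>\<^sub>F m in sequentially. res (X m) n = res x n"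
  proof
    fix n
    have "open {y. res y n = res x n}"
      unfolding open_two_adic_def two_power_dvd_diff_iff by (auto intro!: exI[of _ n])
    from topological_tendstoD[OF lim this]
    show "\<forall>\<^sub>F m in sequentially. res (X m) n = res x n" by simp
  qed
next
  assume ev: "\<forall>n. \<forall>\<^sub>F m in sequentially. res (X m) n = res x n"
  show "X \<longlonglongrightarrow> x"
  proof (rule topological_tendstoI)
    fix S assume "open S" "x \<in> S"
    then obtain n where n: "\<And>y. res y n = res x n \<Longrightarrow> y \<in> S"
      unfolding open_two_adic_def two_power_dvd_diff_iff by blast
    show "\<forall>\<^sub>F m in sequentially. X m \<in> S"
      using ev[rule_format, of n] by (rule eventually_mono) (rule n)
  qed
qed

section \<open>Binary digits\<close>

definition digits :: "two_adic \<Rightarrow> nat \<Rightarrow> nat" where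
  "digits x = (THE d. (\<forall>i. d i \<in> {0, 1}) \<and> (\<lambda>i. of_nat (d i) * 2 ^ i) sums x)"

lemma digit_sum_less:
  assumes "\<forall>i. d i \<in> {0, 1 :: nat}"
  shows "(\<Sum>i<n. d i * 2 ^ i) < 2 ^ n"
proof (induction n)
  case (Suc n)
  have "d n * 2 ^ n \<le> 2 ^ n" using assms[rule_format, of n] by auto
  with Suc have "(\<Sum>i<n. d i * 2 ^ i) + d n * 2 ^ n < 2 ^ n + 2 ^ n"
    by (rule add_less_le_mono)
  then show ?case by simp
qed simp

lemma digit_sums_iff:
  assumes d: "\<forall>i. d i \<in> {0, 1 :: nat}"
  shows "(\<lambda>i. of_nat (d i) * 2 ^ i) sums x \<longleftrightarrow> (\<forall>n. res x n = int (\<Sum>i<n. d i * 2 ^ i))"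
proof -
  have part: "res (\<Sum>i<m. of_nat (d i) * 2 ^ i) n = int (\<Sum>i<n. d i * 2 ^ i)" if "n \<le> m" for m n
  proof -
    have "(\<Sum>i<m. d i * 2 ^ i) = (\<Sum>i<n. d i * 2 ^ i) + (\<Sum>i=n..<m. d i * 2 ^ i)"
      using that by (metis atLeast0LessThan sum.atLeastLessThan_concat zero_le)
    moreover have "2 ^ n dvd (\<Sum>i=n..<m. d i * 2 ^ i)"
      by (rule dvd_sum) (simp add: le_imp_power_dvd)
    ultimately have *: "(\<Sum>i<m. d i * 2 ^ i) mod 2 ^ n = (\<Sum>i<n. d i * 2 ^ i)"
      using digit_sum_less[OF d, of n] by (auto elim!: dvdE)
    have "res (\<Sum>i<m. of_nat (d i) * 2 ^ i) n = res (of_nat (\<Sum>i<m. d i * 2 ^ i)) n"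
      by simp
    also have "\<dots> = int ((\<Sum>i<m. d i * 2 ^ i) mod 2 ^ n)"
      by (simp only: res_of_nat of_nat_mod of_nat_power of_nat_numeral)
    finally show ?thesis using * by simp
  qed
  have "(\<lambda>i. of_nat (d i) * 2 ^ i) sums x \<longleftrightarrow>
      (\<forall>n. \<forall>\<^sub>F m in sequentially. res (\<Sum>i<m. of_nat (d i) * 2 ^ i) n = res x n)"
    by (simp add: sums_def LIMSEQ_two_adic_iff)
  also have "\<dots> \<longleftrightarrow> (\<forall>n. \<forall>\<^sub>F m in sequentially. res x n = int (\<Sum>i<n. d i * 2 ^ i))"
  proof (intro arg_cong[where f = All] ext)
    fix n
    show "(\<forall>\<^sub>F m in sequentially. res (\<Sum>i<m. of_nat (d i) * 2 ^ i) n = res x n) \<longleftrightarrow>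
        (\<forall>\<^sub>F m in sequentially. res x n = int (\<Sum>i<n. d i * 2 ^ i))"
      by (rule eventually_cong[OF eventually_ge_at_top[of n]]) (auto simp only: part)
  qed
  finally show ?thesis by simp
qed

lemma ex1_digits:
  fixes x :: two_adic
  shows "\<exists>!d. (\<forall>i. d i \<in> {0, 1 :: nat}) \<and> (\<lambda>i. of_nat (d i) * 2 ^ i) sums x"
proof (rule ex_ex1I)
  define d where "d i = nat (res x (Suc i) div 2 ^ i)" for i
  have d: "\<forall>i. d i \<in> {0, 1}"
  proof
    fix i
    have "res x (Suc i) div 2 ^ i < 2"
    proof (rule ccontr)
      assume "\<not> ?thesis"
      then have "2 * 2 ^ i \<le> res x (Suc i) div 2 ^ i * 2 ^ i"
        by (intro mult_right_mono) simp_all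
      also have "\<dots> \<le> res x (Suc i)"
        by (metis div_mult_mod_eq le_add_same_cancel1 res_Suc_mod res_nonneg)
      finally show False using res_less[of x "Suc i"] by simp
    qed
    then show "d i \<in> {0, 1}" unfolding d_def by auto
  qed
  have "res x n = int (\<Sum>i<n. d i * 2 ^ i)" for n
  proof (induction n)
    case 0
    then show ?case using res_mod[of x 0] by simp
  next
    case (Suc n)
    have "res x (Suc n) = res x (Suc n) div 2 ^ n * 2 ^ n + res x n"
      by (metis div_mult_mod_eq res_Suc_mod)
    with Suc show ?case by (simp add: d_def pos_imp_zdiv_nonneg_iff)
  qed
  with d show "\<exists>d. (\<forall>i. d i \<in> {0, 1 :: nat}) \<and> (\<lambda>i. of_nat (d i) * 2 ^ i) sums x"
    using digit_sums_iff by blast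
next
  fix d e :: "nat \<Rightarrow> nat"
  assume "(\<forall>i. d i \<in> {0, 1}) \<and> (\<lambda>i. of_nat (d i) * 2 ^ i) sums x"
    and "(\<forall>i. e i \<in> {0, 1}) \<and> (\<lambda>i. of_nat (e i) * 2 ^ i) sums x"
  then have "int (\<Sum>i<n. d i * 2 ^ i) = int (\<Sum>i<n. e i * 2 ^ i)" for n
    using digit_sums_iff by metis
  then have eq: "(\<Sum>i<n. d i * 2 ^ i) = (\<Sum>i<n. e i * 2 ^ i)" for n
    by (simp only: of_nat_eq_iff)
  have "d n = e n" for n using eq[of "Suc n"] eq[of n] by simp
  then show "d = e" ..
qed

lemma digits_01: "digits x i \<in> {0, 1}"
  and digits_sums: "(\<lambda>i. of_nat (digits x i) * 2 ^ i) sums x"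
  using theI'[OF ex1_digits[of x], folded digits_def] by blast+

section \<open>The map \<open>\<Phi>\<close> and the truncation operators\<close>

definition inv3 :: two_adic where
  "inv3 = (THE y. 3 * y = 1)"

lemma inv3: "3 * inv3 = 1"
proof -
  define g :: "nat \<Rightarrow> int" where "g n = (\<Sum>i<n. (-2) ^ i) mod 2 ^ n" for n
  have coh: "g (Suc n) mod 2 ^ n = g n" for n
  proof -
    have "(-2) ^ n mod 2 ^ n = (0::int)"
      by (simp add: power_minus[of 2] mod_eq_0_iff_dvd)
    then have "(\<Sum>i<Suc n. (-2) ^ i) mod 2 ^ n = (\<Sum>i<n. (-2) ^ i :: int) mod 2 ^ n"
      by (metis add.right_neutral mod_add_right_eq sum.lessThan_Suc)
    then show ?thesis unfolding g_def mod_2_power_mod_Suc by simp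
  qed
  define y where "y = Abs_two_adic g"
  have y: "res y n = g n" for n
    unfolding y_def using coh by (subst Abs_two_adic_inverse) auto
  have 3: "of_int 3 * y = 1"
  proof (rule two_adic_eqI)
    fix n
    have "3 * (\<Sum>i<n. (-2) ^ i) = 1 - (-2 :: int) ^ n"
      by (induction n) (simp_all add: algebra_simps)
    then have "res (of_int 3 * y) n = (1 - (-2) ^ n) mod 2 ^ n"
      by (simp only: res_mult res_of_int y g_def mod_simps)
    also have "\<dots> = 1 mod 2 ^ n"
      by (subst mod_eq_dvd_iff) (simp add: power_minus[of 2])
    finally show "res (of_int 3 * y) n = res 1 n" by (simp add: res_one)
  qed
  then have "3 * y = 1" by simp
  moreover have "z = y" if "3 * z = 1" for z
    using that calculation by (metis mult.assoc mult.commute mult_1)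
  ultimately show ?thesis unfolding inv3_def by (metis (mono_tags, lifting) theI)
qed

definition ones :: "two_adic \<Rightarrow> nat set" where
  "ones x = {i. digits x i = 1}"

text \<open>The exponents \<open>e\<^sub>0 < e\<^sub>1 < \<dots>\<close> in \<open>x = \<Sum>\<^sub>i 2\<^bsup>e\<^sub>i\<^esup>\<close> are the elements of
  \<open>ones x\<close> in increasing order, \<open>e\<^sub>i = enumerate (ones x) i\<close>.\<close>

definition Phi :: "two_adic \<Rightarrow> two_adic" where
  "Phi x = - (if finite (ones x)
     then \<Sum>i<card (ones x). 2 ^ enumerate (ones x) i * inv3 ^ i
     else \<Sum>i. 2 ^ enumerate (ones x) i * inv3 ^ i)"

definition L :: "nat \<Rightarrow> two_adic \<Rightarrow> nat" where
  "L c x = (LEAST n. 2 ^ c dvd (x - of_nat n))"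

definition R :: "nat \<Rightarrow> two_adic \<Rightarrow> two_adic" where
  "R c x = (\<Sum>i. of_nat (digits x (c + i)) * 2 ^ i)"

text \<open>For \<open>v = 0\<close> the series diverges, but then \<open>b < 2\<^sup>v\<close> forces \<open>b = 0\<close> and the
  value is \<open>0\<close>.\<close>

definition bar_inf :: "nat \<Rightarrow> nat \<Rightarrow> two_adic" where
  "bar_inf b v = of_nat b * (\<Sum>i. 2 ^ (v * i))"

definition two_adic_rationals :: "two_adic set" where
  "two_adic_rationals = {x. \<exists>m n :: int. n \<noteq> 0 \<and> of_int n * x = of_int m}"

end

theory Submission
  imports Defs
begin

text \<open>
  Put \<open>c = k + t v\<close>, let \<open>s\<close> be the number of ones among the first \<open>c\<close> digits of \<open>q\<close>, and let \<open>B\<close>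
  be the periodic tail of \<open>q\<close>, so that \<open>R\<^sub>c(q) = B\<close>. Splitting the series for \<open>\<Phi>\<close> at position \<open>c\<close> gives
  \<open>\<Phi>(q) = \<Phi>(L\<^sub>c(q)) + 2\<^sup>c 3\<^bsup>-s\<^esup> \<Phi>(B)\<close>, hence \<open>R\<^sub>c(\<Phi>(L\<^sub>c(q))) = R\<^sub>c(\<Phi>(q)) - 3\<^bsup>-s\<^esup> \<Phi>(B)\<close>.
  Replacing \<open>t\<close> by \<open>t + p 2\<^sup>H\<close> leaves \<open>R\<^sub>c(\<Phi>(q))\<close> unchanged by periodicity and increases \<open>s\<close> by a
  multiple of \<open>2\<^sup>H\<close>, and \<open>3\<close> raised to the power \<open>2\<^sup>H\<close> is congruent to 1 modulo \<open>2\<^bsup>H+2\<^esup>\<close>.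
\<close>

section \<open>Equality and cancellation through divisibility by powers of 2\<close>

lemma two_adic_eqI_dvd:
  assumes "\<And>n. 2 ^ n dvd (x - y :: two_adic)"
  shows "x = y"
  using assms by (intro two_adic_eqI) (simp add: two_power_dvd_diff_iff)

text \<open>There is no 2-torsion: if \<open>2 ^ c * z = 0\<close>, then
  \<open>res z (c + n)\<close> is divisible by \<open>2 ^ n\<close>, and it reduces to
  \<open>res z n\<close>.\<close>

lemma two_power_mult_cancel:
  fixes x y :: two_adic
  assumes "2 ^ c * x = 2 ^ c * y"
  shows "x = y"
proof (rule two_adic_eqI_dvd)
  fix n
  define z where "z = x - y"
  have z: "of_int (2 ^ c) * z = 0" using assms by (simp add: z_def right_diff_distrib)
  have "2 ^ c * res z (c + n) mod (2 ^ c * 2 ^ n) = 0"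
    using arg_cong[OF z, of "\<lambda>w. res w (c + n)"]
    by (simp only: res_mult res_of_int mod_simps res_zero power_add)
  then have "2 ^ c * (res z (c + n) mod 2 ^ n) = 0"
    by (simp only: mult_mod_right)
  then have "res z n = 0" by (simp add: res_mod_le)
  then show "2 ^ n dvd (x - y)" by (simp add: two_power_dvd_iff z_def)
qed

section \<open>Convergence of series with terms divisible by increasing powers of 2\<close>

text \<open>Modulo \<open>2 ^ n\<close> the partial sums are constant from length \<open>n\<close>
  on. Convergence thus becomes a family of divisibilities, and identities between infinite sums can
  be checked on partial sums.\<close>

lemma sums_two_adic_iff:
  fixes f :: "nat \<Rightarrow> two_adic"
  assumes f: "\<And>i. 2 ^ i dvd f i"
  shows "f sums x \<longleftrightarrow> (\<forall>n. 2 ^ n dvd (x - sum f {..<n}))"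
proof -
  have part: "res (sum f {..<m}) n = res (sum f {..<n}) n" if "n \<le> m" for m n
  proof -
    have "sum f {..<m} - sum f {..<n} = sum f {n..<m}"
      using that by (metis add_diff_cancel_left' atLeast0LessThan sum.atLeastLessThan_concat zero_le)
    moreover have "2 ^ n dvd sum f {n..<m}"
      by (rule dvd_sum) (meson atLeastLessThan_iff dvd_trans f le_imp_power_dvd)
    ultimately show ?thesis by (metis two_power_dvd_diff_iff)
  qed
  have "f sums x \<longleftrightarrow> (\<forall>n. \<forall>\<^sub>F m in sequentially. res (sum f {..<m}) n = res x n)"
    by (simp add: sums_def LIMSEQ_two_adic_iff)
  also have "\<dots> \<longleftrightarrow> (\<forall>n. \<forall>\<^sub>F m in sequentially. res x n = res (sum f {..<n}) n)"
  proof (intro arg_cong[where f = All] ext)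
    fix n
    show "(\<forall>\<^sub>F m in sequentially. res (sum f {..<m}) n = res x n) \<longleftrightarrow>
        (\<forall>\<^sub>F m in sequentially. res x n = res (sum f {..<n}) n)"
      by (rule eventually_cong[OF eventually_ge_at_top[of n]]) (drule part, metis)
  qed
  finally show ?thesis by (simp add: two_power_dvd_diff_iff)
qed

text \<open>The residues of the diagonal partial sums are coherent, so they define the limit
  directly.\<close>

lemma summable_two_adic:
  fixes f :: "nat \<Rightarrow> two_adic"
  assumes f: "\<And>i. 2 ^ i dvd f i"
  shows "summable f"
proof -
  define g where "g n = res (sum f {..<n}) n" for n
  have "g (Suc n) mod 2 ^ n = g n" for n
  proof -
    have "2 ^ n dvd (sum f {..<Suc n} - sum f {..<n})" using f by simp
    then show ?thesis
      by (simp only: g_def res_Suc_mod two_power_dvd_diff_iff)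
  qed
  then have "res (Abs_two_adic g) n = g n" for n
    by (subst Abs_two_adic_inverse) auto
  then have "f sums Abs_two_adic g"
    by (simp add: sums_two_adic_iff[OF f] two_power_dvd_diff_iff g_def)
  then show ?thesis by (rule sums_summable)
qed

section \<open>Digits and truncation\<close>

lemma digits_dvd: "2 ^ n dvd (x - of_nat (\<Sum>i<n. digits x i * 2 ^ i))"
proof -
  have "\<And>i. 2 ^ i dvd (of_nat (digits x i) * 2 ^ i :: two_adic)" by simp
  from sums_two_adic_iff[OF this] show ?thesis using digits_sums[of x] by simp
qed

lemma digits_eqI:
  assumes "\<And>i. d i \<in> {0, 1 :: nat}" and "\<And>n. 2 ^ n dvd (x - of_nat (\<Sum>i<n. d i * 2 ^ i))"
  shows "digits x = d"
proof -
  have "\<And>i. 2 ^ i dvd (of_nat (d i) * 2 ^ i :: two_adic)" by simp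
  from sums_two_adic_iff[OF this] have "(\<lambda>i. of_nat (d i) * 2 ^ i) sums x"
    using assms(2) by simp
  then show ?thesis using ex1_digits[of x] digits_01 digits_sums assms(1) by blast
qed

lemma R_dvd: "2 ^ n dvd (R c x - of_nat (\<Sum>i<n. digits x (c + i) * 2 ^ i))"
proof -
  have d: "\<And>i. 2 ^ i dvd (of_nat (digits x (c + i)) * 2 ^ i :: two_adic)" by simp
  have "(\<lambda>i. of_nat (digits x (c + i)) * 2 ^ i) sums R c x"
    unfolding R_def by (rule summable_sums) (rule summable_two_adic[OF d])
  with sums_two_adic_iff[OF d] show ?thesis by simp
qed

lemma digits_R: "digits (R c x) = (\<lambda>i. digits x (c + i))"
  by (rule digits_eqI) (rule digits_01, rule R_dvd)

lemma digits_R_split: "x = of_nat (\<Sum>i<c. digits x i * 2 ^ i) + 2 ^ c * R c x"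
proof (rule two_adic_eqI_dvd)
  fix n
  let ?S = "\<lambda>n. \<Sum>i<n. digits x i * 2 ^ i" and ?T = "\<Sum>i<n. digits x (c + i) * 2 ^ i"
  have "?S (c + n) = ?S c + 2 ^ c * ?T"
    by (induction n) (simp_all add: algebra_simps power_add)
  then have "x - (of_nat (?S c) + 2 ^ c * R c x) =
      (x - of_nat (?S (c + n))) - 2 ^ c * (R c x - of_nat ?T)"
    by (simp add: algebra_simps)
  moreover have "2 ^ n dvd (x - of_nat (?S (c + n)))"
    by (rule dvd_trans[OF _ digits_dvd]) (simp add: le_imp_power_dvd)
  moreover have "2 ^ n dvd 2 ^ c * (R c x - of_nat ?T)"
    by (rule dvd_mult) (rule R_dvd)
  ultimately show "2 ^ n dvd (x - (of_nat (?S c) + 2 ^ c * R c x))"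
    by (simp only: dvd_diff)
qed

lemma L_eq:
  assumes "n < 2 ^ c"
  shows "L c (of_nat n + 2 ^ c * y) = n"
  unfolding L_def
proof (rule Least_equality)
  fix m assume "2 ^ c dvd (of_nat n + 2 ^ c * y - of_nat m)"
  then have "2 ^ c dvd ((of_nat n + 2 ^ c * y - of_nat m) - 2 ^ c * y)"
    by (rule dvd_diff) simp
  then have "2 ^ c dvd (of_nat n - of_nat m :: two_adic)" by (simp add: algebra_simps)
  then have "int n mod 2 ^ c = int m mod 2 ^ c"
    by (simp only: two_power_dvd_diff_iff res_of_nat)
  then have "int (n mod 2 ^ c) = int (m mod 2 ^ c)" by (simp add: of_nat_mod)
  then show "n \<le> m" using assms by (metis mod_less mod_less_eq_dividend of_nat_eq_iff)
qed simp

lemma L_eq_digit_sum: "L c x = (\<Sum>i<c. digits x i * 2 ^ i)"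
proof -
  have "(\<Sum>i<c. digits x i * 2 ^ i) < 2 ^ c"
    by (intro digit_sum_less allI digits_01)
  from L_eq[OF this, of "R c x"] show ?thesis
    by (simp only: digits_R_split[of x c, symmetric])
qed

lemma L_R_split: "x = of_nat (L c x) + 2 ^ c * R c x"
  unfolding L_eq_digit_sum by (rule digits_R_split)

lemma R_eq:
  assumes "n < 2 ^ c"
  shows "R c (of_nat n + 2 ^ c * y) = y"
proof -
  have "of_nat n + 2 ^ c * y = of_nat n + 2 ^ c * R c (of_nat n + 2 ^ c * y)"
    using L_R_split[of "of_nat n + 2 ^ c * y" c] unfolding L_eq[OF assms] .
  then have "2 ^ c * y = 2 ^ c * R c (of_nat n + 2 ^ c * y)" by (rule add_left_imp_eq)
  then show ?thesis using two_power_mult_cancel by metis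
qed

lemma L_less: "L c x < 2 ^ c"
  unfolding L_eq_digit_sum by (intro digit_sum_less allI digits_01)

text \<open>Subtracting a multiple of \<open>2 ^ c\<close> causes no borrow from the positions below
  \<open>c\<close>, so \<open>L c x\<close> remains the low part.\<close>

lemma R_diff_two_power_mult: "R c (x - 2 ^ c * y) = R c x - y"
proof -
  have "x - 2 ^ c * y = of_nat (L c x) + 2 ^ c * (R c x - y)"
    using arg_cong[OF L_R_split[of x c], of "\<lambda>z. z - 2 ^ c * y"] by (simp add: algebra_simps)
  then show ?thesis using R_eq[OF L_less] by metis
qed

lemma digits_of_nat_L: "digits (of_nat (L c x)) = (\<lambda>i. if i < c then digits x i else 0)"
proof (rule digits_eqI)
  fix n
  show "2 ^ n dvd (of_nat (L c x) -
      of_nat (\<Sum>i<n. (if i < c then digits x i else 0) * 2 ^ i) :: two_adic)"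
  proof (cases "n \<le> c")
    case True
    then have "(\<Sum>i<n. (if i < c then digits x i else 0) * 2 ^ i) = (\<Sum>i<n. digits x i * 2 ^ i)"
      by (intro sum.cong) auto
    moreover have "2 ^ n dvd (of_nat (L c x) - x)"
    proof -
      have "of_nat (L c x) - x = 2 ^ c * (- R c x)"
        using L_R_split[of x c] by (simp add: algebra_simps)
      then show ?thesis using True by (simp add: le_imp_power_dvd dvd_mult2)
    qed
    ultimately show ?thesis using dvd_add[OF _ digits_dvd[of n x]] by fastforce
  next
    case False
    then have "(\<Sum>i<n. (if i < c then digits x i else 0) * 2 ^ i) = (\<Sum>i<c. digits x i * 2 ^ i)"
      by (intro sum.mono_neutral_cong_right) auto
    then show ?thesis by (simp add: L_eq_digit_sum)
  qed
qed (use digits_01 in auto)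

section \<open>The map \<open>\<Phi>\<close> as a series over digit positions\<close>

definition ones_below :: "two_adic \<Rightarrow> nat \<Rightarrow> nat" where
  "ones_below x c = (\<Sum>i<c. digits x i)"

text \<open>Indexing by digit position rather than by rank covers finite and infinite
  \<open>ones x\<close> with one series: a zero digit kills the term, and at a one
  \<open>ones_below x i\<close> is its rank, the exponent of 1/3 in \<open>Phi\<close>.\<close>

definition Phi_term :: "two_adic \<Rightarrow> nat \<Rightarrow> two_adic" where
  "Phi_term x i = of_nat (digits x i) * 2 ^ i * inv3 ^ ones_below x i"

lemma Phi_term_dvd: "2 ^ i dvd Phi_term x i"
  by (simp add: Phi_term_def dvd_mult2)

lemma ones_below_eq_card: "ones_below x c = card {i \<in> ones x. i < c}"
proof -
  have "ones_below x c = (\<Sum>i<c. if i \<in> ones x then 1 else 0)"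
    unfolding ones_below_def ones_def using digits_01[of x] by (intro sum.cong) auto
  also have "\<dots> = card {i \<in> ones x. i < c}"
    by (simp add: sum.If_cases) (metis Collect_conj_eq Int_commute lessThan_def Collect_mem_eq)
  finally show ?thesis .
qed

lemma Phi_term_ones: "i \<in> ones x \<Longrightarrow> Phi_term x i = 2 ^ i * inv3 ^ card {j \<in> ones x. j < i}"
  unfolding Phi_term_def ones_below_eq_card by (simp add: ones_def)

lemma Phi_term_not_ones: "i \<notin> ones x \<Longrightarrow> Phi_term x i = 0"
  using digits_01[of x i] by (auto simp: Phi_term_def ones_def)

text \<open>Strict monotonicity of \<open>enumerate\<close> makes the elements below the
  \<open>i\<close>-th one exactly the image of \<open>{..<i}\<close>. The conditional assumption
  treats finite and infinite \<open>S\<close> together.\<close>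

lemma card_less_enumerate:
  fixes S :: "nat set"
  assumes "finite S \<Longrightarrow> i < card S"
  shows "card {j \<in> S. j < enumerate S i} = i"
proof -
  have mono: "enumerate S m < enumerate S n \<longleftrightarrow> m < n"
    if "finite S \<Longrightarrow> m < card S" "finite S \<Longrightarrow> n < card S" for m n
    using that by (cases "finite S") simp_all
  have "{j \<in> S. j < enumerate S i} = enumerate S ` {..<i}"
  proof (intro equalityI subsetI)
    fix j assume j: "j \<in> {j \<in> S. j < enumerate S i}"
    then obtain n where n: "finite S \<Longrightarrow> n < card S" "enumerate S n = j"
      by (metis (mono_tags, lifting) enumerate_Ex finite_enumerate_Ex mem_Collect_eq)
    then have "n < i" using j mono[of n i] assms by auto
    then show "j \<in> enumerate S ` {..<i}" using n(2) by auto
  next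
    fix j assume "j \<in> enumerate S ` {..<i}"
    then obtain n where n: "n < i" "j = enumerate S n" by auto
    then have "finite S \<Longrightarrow> n < card S" using assms by auto
    then show "j \<in> {j \<in> S. j < enumerate S i}"
      using n mono[of n i] assms enumerate_in_set finite_enumerate_in_set by blast
  qed
  moreover have "inj_on (enumerate S) {..<i}"
  proof (rule inj_onI)
    fix m n assume "m \<in> {..<i}" "n \<in> {..<i}" "enumerate S m = enumerate S n"
    then show "m = n" using mono[of m n] mono[of n m] assms
      by (metis lessThan_iff less_irrefl less_trans linorder_neqE_nat)
  qed
  ultimately show ?thesis by (simp add: card_image)
qed

text \<open>Both branches of the definition of \<open>Phi\<close> are this series reindexed along
  \<open>enumerate (ones x)\<close>; the positions left out contribute 0.\<close>

lemma Phi_term_sums: "Phi_term x sums (- Phi x)"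
proof (cases "finite (ones x)")
  case True
  have bij: "bij_betw (enumerate (ones x)) {..<card (ones x)} (ones x)"
    by (rule finite_bij_enumerate[OF True])
  have "card {j \<in> ones x. j < enumerate (ones x) i} = i" if "i < card (ones x)" for i
    using that True by (intro card_less_enumerate) auto
  then have "(\<Sum>i<card (ones x). 2 ^ enumerate (ones x) i * inv3 ^ i) =
      (\<Sum>i<card (ones x). Phi_term x (enumerate (ones x) i))"
    using True by (intro sum.cong) (simp_all add: Phi_term_ones finite_enumerate_in_set)
  also have "\<dots> = (\<Sum>i\<in>ones x. Phi_term x i)"
    by (rule sum.reindex_bij_betw[OF bij])
  finally have "- Phi x = (\<Sum>i\<in>ones x. Phi_term x i)"
    using True by (simp add: Phi_def)
  moreover have "Phi_term x sums (\<Sum>i\<in>ones x. Phi_term x i)"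
    using True by (intro sums_finite) (auto intro: Phi_term_not_ones)
  ultimately show ?thesis by simp
next
  case False
  have "card {j \<in> ones x. j < enumerate (ones x) i} = i" for i
    using False by (intro card_less_enumerate) auto
  then have eq: "(\<lambda>i. 2 ^ enumerate (ones x) i * inv3 ^ i) =
      (\<lambda>i. Phi_term x (enumerate (ones x) i))"
    using False by (simp add: Phi_term_ones enumerate_in_set)
  have "Phi_term x sums (\<Sum>i. Phi_term x i)"
    by (rule summable_sums) (rule summable_two_adic[OF Phi_term_dvd])
  moreover have "(\<lambda>i. Phi_term x (enumerate (ones x) i)) sums s \<longleftrightarrow> Phi_term x sums s" for s
    using False by (intro sums_mono_reindex)
      (auto simp: strict_mono_enumerate range_enumerate intro: Phi_term_not_ones)
  ultimately show ?thesis
    using False by (simp add: Phi_def eq) (metis sums_unique)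
qed

lemma Phi_dvd: "2 ^ n dvd (- Phi x - sum (Phi_term x) {..<n})"
  using Phi_term_sums[of x] sums_two_adic_iff[of "Phi_term x", OF Phi_term_dvd] by blast

lemma ones_below_add: "ones_below x (c + d) = ones_below x c + ones_below (R c x) d"
  by (induction d) (simp_all add: ones_below_def digits_R)

lemma Phi_term_add: "Phi_term x (c + i) = 2 ^ c * inv3 ^ ones_below x c * Phi_term (R c x) i"
  by (simp add: Phi_term_def ones_below_add digits_R power_add mult_ac)

lemma Phi_of_nat_L: "- Phi (of_nat (L c x)) = sum (Phi_term x) {..<c}"
proof -
  have term_eq: "Phi_term (of_nat (L c x)) i = (if i < c then Phi_term x i else 0)" for i
    by (simp add: Phi_term_def ones_below_def digits_of_nat_L)
  have "Phi_term (of_nat (L c x)) sums (\<Sum>i<c. Phi_term (of_nat (L c x)) i)"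
    by (rule sums_finite) (auto simp: term_eq)
  with Phi_term_sums have "- Phi (of_nat (L c x)) = (\<Sum>i<c. Phi_term (of_nat (L c x)) i)"
    by (rule sums_unique2)
  also have "\<dots> = sum (Phi_term x) {..<c}"
    by (rule sum.cong) (simp_all add: term_eq)
  finally show ?thesis .
qed

text \<open>The terms below \<open>c\<close> give the truncation; by \<open>Phi_term_add\<close> the
  later ones form the series of \<open>R c x\<close>, scaled. Comparing partial sums of lengths
  \<open>c + n\<close> and \<open>n\<close> leaves only errors divisible by
  \<open>2 ^ n\<close>.\<close>

lemma Phi_split: "Phi x = Phi (of_nat (L c x)) + 2 ^ c * (inv3 ^ ones_below x c * Phi (R c x))"
proof (rule two_adic_eqI_dvd)
  fix n
  define s where "s = inv3 ^ ones_below x c"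
  let ?P = "\<lambda>x n. sum (Phi_term x) {..<n}"
  have "?P x (c + n) = ?P x c + 2 ^ c * s * ?P (R c x) n"
    by (induction n) (simp_all add: Phi_term_add s_def distrib_left add.assoc)
  then have "Phi x - (Phi (of_nat (L c x)) + 2 ^ c * (s * Phi (R c x))) =
      2 ^ c * s * (- Phi (R c x) - ?P (R c x) n) - (- Phi x - ?P x (c + n))"
    by (simp add: Phi_of_nat_L[of c x, symmetric] algebra_simps)
  moreover have "2 ^ n dvd 2 ^ c * s * (- Phi (R c x) - ?P (R c x) n)"
    by (rule dvd_mult) (rule Phi_dvd)
  moreover have "2 ^ n dvd (- Phi x - ?P x (c + n))"
    by (rule dvd_trans[OF _ Phi_dvd]) (simp add: le_imp_power_dvd)
  ultimately show "2 ^ n dvd (Phi x - (Phi (of_nat (L c x)) + 2 ^ c * (inv3 ^ ones_below x c * Phi (R c x))))"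
    unfolding s_def by (simp only: dvd_diff)
qed

text \<open>This isolates the dependence on \<open>c\<close>: if \<open>R c (Phi x)\<close> and
  \<open>R c x\<close> agree for two values of \<open>c\<close>, only the power of
  \<open>inv3\<close> differs.\<close>

lemma R_Phi_of_nat_L: "R c (Phi (of_nat (L c x))) = R c (Phi x) - inv3 ^ ones_below x c * Phi (R c x)"
proof -
  have "Phi (of_nat (L c x)) = Phi x - 2 ^ c * (inv3 ^ ones_below x c * Phi (R c x))"
    using Phi_split[of x c] by (simp add: algebra_simps)
  then show ?thesis by (simp only: R_diff_two_power_mult)
qed

section \<open>Eventually periodic expansions\<close>

text \<open>The leading term of the geometric series is split off. Positivity of \<open>v\<close>
  makes the \<open>i\<close>-th term divisible by \<open>2 ^ i\<close>, which gives
  convergence.\<close>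

lemma bar_inf_unfold:
  assumes "v > 0"
  shows "bar_inf b v = of_nat b + 2 ^ v * bar_inf b v"
proof -
  let ?f = "\<lambda>i. 2 ^ (v * i) :: two_adic"
  define G where "G = suminf ?f"
  have f: "2 ^ i dvd ?f i" for i
    using assms by (simp add: le_imp_power_dvd)
  have "?f sums G" unfolding G_def by (rule summable_sums) (rule summable_two_adic[OF f])
  then have dvd: "2 ^ n dvd (G - sum ?f {..<n})" for n
    using sums_two_adic_iff[OF f] by blast
  have "G = 1 + 2 ^ v * G"
  proof (rule two_adic_eqI_dvd)
    fix n
    have "sum ?f {..<Suc n} = 1 + 2 ^ v * sum ?f {..<n}"
      by (simp only: sum.lessThan_Suc_shift sum_distrib_left) (simp add: power_add)
    then have "G - (1 + 2 ^ v * G) = (G - sum ?f {..<Suc n}) - 2 ^ v * (G - sum ?f {..<n})"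
      by (simp only:) (simp add: algebra_simps)
    moreover have "2 ^ n dvd (G - sum ?f {..<Suc n})"
      by (rule dvd_trans[OF _ dvd]) (simp add: le_imp_power_dvd)
    moreover have "2 ^ n dvd 2 ^ v * (G - sum ?f {..<n})"
      by (rule dvd_mult) (rule dvd)
    ultimately show "2 ^ n dvd (G - (1 + 2 ^ v * G))" by (simp only: dvd_diff)
  qed
  then have "of_nat b * G = of_nat b * (1 + 2 ^ v * G)" by (rule arg_cong)
  also have "\<dots> = of_nat b + 2 ^ v * (of_nat b * G)" by (simp add: algebra_simps)
  finally show ?thesis unfolding bar_inf_def G_def .
qed

lemma R_bar_inf:
  assumes "b < 2 ^ v"
  shows "R v (bar_inf b v) = bar_inf b v"
proof (cases "v = 0")
  case True
  \<comment> \<open>Here \<open>b < 2 ^ 0\<close> forces \<open>b = 0\<close>, so the value of the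
    divergent series is irrelevant.\<close>
  then have "bar_inf b v = of_nat 0 + 2 ^ v * 0" using assms by (simp add: bar_inf_def)
  then show ?thesis using R_eq[of 0 v 0] by simp
next
  case False
  then have "bar_inf b v = of_nat b + 2 ^ v * bar_inf b v" by (intro bar_inf_unfold) simp
  with R_eq[OF assms, of "bar_inf b v"] show ?thesis by metis
qed

lemma R_add: "R (c + d) x = R d (R c x)"
  by (simp add: R_def[of "c + d"] R_def[of d] digits_R add.assoc)

lemma R_fixed_mult: "R v x = x \<Longrightarrow> R (m * v) x = x"
proof (induction m)
  case 0
  show ?case using R_eq[of 0 0 x] by simp
qed (simp add: R_add)

text \<open>A fixed point of \<open>R v\<close> repeats its first \<open>v\<close> digits, so every
  block has equally many ones.\<close>

lemma ones_below_fixed_mult: "R v x = x \<Longrightarrow> ones_below x (m * v) = m * ones_below x v"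
  by (induction m) (simp_all add: ones_below_add, simp add: ones_below_def)

lemma R_periodic:
  assumes per: "\<forall>i\<ge>u. digits y (i + p) = digits y i" and "u \<le> c"
  shows "R (c + m * p) y = R c y"
proof -
  have "digits y (c + m * p + i) = digits y (c + i)" for i
  proof (induction m)
    case (Suc m)
    have "digits y (c + m * p + i + p) = digits y (c + m * p + i)"
      using per \<open>u \<le> c\<close> by simp
    with Suc show ?case by (simp add: add_ac)
  qed simp
  then show ?thesis by (simp add: R_def)
qed

text \<open>Each squaring adds a factor 2, since \<open>y ^ 2 - 1 = (y + 1) * (y - 1)\<close> with
  \<open>y + 1\<close> even for a power \<open>y\<close> of 3. The induction starts at
  \<open>H = 1\<close> with \<open>3 ^ 2 - 1 = 8\<close>.\<close>

lemma two_power_dvd_three_power_minus_one: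
  assumes "H > 0"
  shows "2 ^ (H + 2) dvd (3 ^ 2 ^ H - 1 :: 'a :: comm_ring_1)"
  using assms
proof (induction H rule: nat_induct_non_zero)
  case 1
  show ?case by simp
next
  case (Suc H)
  have even: "2 dvd (3 ^ n + 1 :: 'a)" for n
  proof (induction n)
    case (Suc n)
    have "(3 ^ Suc n + 1 :: 'a) = 2 * 3 ^ n + (3 ^ n + 1)" by (simp add: algebra_simps)
    with Suc show ?case by (metis dvd_add dvd_triv_left)
  qed simp
  have "(3 ^ 2 ^ Suc H - 1 :: 'a) = (3 ^ 2 ^ H + 1) * (3 ^ 2 ^ H - 1)"
    by (simp add: algebra_simps power_add[symmetric] mult_2)
  with mult_dvd_mono[OF even Suc.IH] show ?case by simp
qed

lemma two_power_dvd_inv3_power_diff: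
  assumes "H > 0"
  shows "2 ^ (H + 2) dvd (inv3 ^ s - inv3 ^ (s + 2 ^ H * m))"
proof -
  have "3 ^ n * inv3 ^ n = 1" for n
    by (simp add: power_mult_distrib[symmetric] inv3)
  \<comment> \<open>Pulling out the higher power of \<open>inv3\<close> turns the difference into
    one of powers of 3.\<close>
  then have "inv3 ^ s - inv3 ^ (s + 2 ^ H * m) = inv3 ^ (s + 2 ^ H * m) * (3 ^ (2 ^ H * m) - 1)"
    by (simp add: power_add algebra_simps)
  moreover have "(3 ^ 2 ^ H - 1) dvd (3 ^ (2 ^ H * m) - 1 :: two_adic)"
    by (simp add: power_mult power_diff_1_eq)
  ultimately show ?thesis
    using two_power_dvd_three_power_minus_one[OF assms] by (metis dvd_mult dvd_trans)
qed

theorem theorem15: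
  fixes q :: two_adic and a k b v u p t :: nat
  assumes "q \<in> two_adic_rationals"
    and "a < 2 ^ k" and "b < 2 ^ v"
    and "q = of_nat a + 2 ^ k * bar_inf b v"
    and "p > 0"
    and "\<forall>i\<ge>u. digits (Phi q) (i + p) = digits (Phi q) i"
    and "k + t * v \<ge> u"
  shows "\<forall>H::nat. H > 0 \<longrightarrow>
    2 ^ (H + 2) dvd
      (R (k + t * v) (Phi (of_nat (L (k + t * v) q)))
       - R (k + (t + p * 2 ^ H) * v) (Phi (of_nat (L (k + (t + p * 2 ^ H) * v) q))))"
proof (intro allI impI)
  fix H :: nat assume "H > 0"
  define B where "B = bar_inf b v"
  define c where "c = k + t * v"
  define c' where "c' = k + (t + p * 2 ^ H) * v"
  have B: "R v B = B" unfolding B_def by (rule R_bar_inf) fact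
  have RB: "R (k + m * v) q = B" for m
    using R_eq[OF \<open>a < 2 ^ k\<close>] assms(4) by (simp add: R_add R_fixed_mult[OF B] B_def[symmetric])
  \<comment> \<open>The increment serves two purposes: it is \<open>2 ^ H * p\<close> blocks of
    length \<open>v\<close> in \<open>q\<close>, and \<open>2 ^ H * v\<close> periods of length
    \<open>p\<close> in \<open>Phi q\<close>.\<close>
  have c': "c' = c + 2 ^ H * p * v" by (simp add: c_def c'_def algebra_simps)
  have ones: "ones_below q c' = ones_below q c + 2 ^ H * (p * ones_below B v)"
    by (simp add: c' ones_below_add ones_below_fixed_mult[OF B] RB c_def)
  have "R c' (Phi q) = R c (Phi q)"
    using R_periodic[OF assms(6), of c "2 ^ H * v"] assms(7) by (simp add: c' c_def mult_ac)
  \<comment> \<open>The tails of \<open>Phi q\<close> cancel, and both tails of \<open>q\<close>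
    equal \<open>B\<close>.\<close>
  then have "R c (Phi (of_nat (L c q))) - R c' (Phi (of_nat (L c' q))) =
      - (inv3 ^ ones_below q c - inv3 ^ ones_below q c') * Phi B"
    using RB[of t, folded c_def] RB[of "t + p * 2 ^ H", folded c'_def]
    by (simp add: R_Phi_of_nat_L left_diff_distrib)
  moreover have "2 ^ (H + 2) dvd - (inv3 ^ ones_below q c - inv3 ^ ones_below q c') * Phi B"
    unfolding ones using two_power_dvd_inv3_power_diff[OF \<open>H > 0\<close>] by (simp only: dvd_mult2 dvd_minus_iff)
  ultimately show "2 ^ (H + 2) dvd
      (R (k + t * v) (Phi (of_nat (L (k + t * v) q)))
       - R (k + (t + p * 2 ^ H) * v) (Phi (of_nat (L (k + (t + p * 2 ^ H) * v) q))))"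
    by (simp only: c_def c'_def)
qed

end
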